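(* Let $K,N\ge1$, $M\ge KN$, and let $\mathbf H_1,\dots,\mathbf H_K\in\mathbb C^{N\times M}$ be such that the stacked $KN\times M$ matrix has full row rank. Let $\mu_1\ge\dots\ge\mu_K\ge0$ with $\sum_k\mu_k=1$. For positive semidefinite $N\times N$ matrices $\mathbf Q_1,\dots,\mathbf Q_K$ let $\mathbf A^{(0)}=\mathbf I_M$, $\mathbf A^{(k)}=\mathbf I_M+\sum_{j=1}^k\mathbf H_j^H\mathbf Q_j\mathbf H_j$, let $R(\mathbf Q_1,\dots,\mathbf Q_K)=\sum_{k=1}^K\mu_k\log_2\frac{|\mathbf A^{(k)}|}{|\mathbf A^{(k-1)}|}$, and $$\mathcal C_{\mathrm{DPC}}(\boldsymbol\mu,\mathbf H,P)=\max_{\mathbf Q_k\succeq0,\ \sum_k\mathrm{tr}(\mathbf Q_k)\le P}R(\mathbf Q_1,\dots,\mathbf Q_K).$$ Then the choice $\mathbf Q_k=\frac{\mu_kP}{N}\mathbf I_N$, $k=1,\dots,K$, asymptotically achieves the optimum at high SNR: $$\lim_{P\to\infty}\left[\mathcal C_{\mathrm{DPC}}(\boldsymbol\mu,\mathbf H,P)-R\!\left(\tfrac{\mu_1P}{N}\mathbf I_N,\dots,\tfrac{\mu_KP}{N}\mathbf I_N\right)\right]=0.$$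
   Context: $\mathcal C_{\mathrm{DPC}}(\boldsymbol\mu,\mathbf H,P)$ is the maximum weighted sum rate over the dirty-paper-coding capacity region of the MIMO broadcast channel with $M$ transmit antennas and $K$ users with $N$ antennas each (channels $\mathbf H_k$), unit noise and total power $P$, expressed via the dual multiple-access channel with covariances $\mathbf Q_k$ and user $k$ decoded in the presence of users $1,\dots,k-1$. *)

theory Defs
  imports Complex_Main "Jordan_Normal_Form.DL_Rank" "Jordan_Normal_Form.Schur_Decomposition"
begin

text \<open>Complex matrices are JNF matrices (type complex mat) with explicit dimensions.
  Users are indexed 0..K-1 (user k of the paper is index k-1).\<close>

definition mtrace :: "complex mat \<Rightarrow> complex" where
  "mtrace Q = (\<Sum>i<dim_row Q. Q $$ (i,i))"

definition psd :: "nat \<Rightarrow> complex mat \<Rightarrow> bool" where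
  "psd n Q \<longleftrightarrow> Q \<in> carrier_mat n n \<and> mat_adjoint Q = Q \<and>
     (\<forall>v\<in>carrier_vec n. Re (conjugate v \<bullet> (Q *\<^sub>v v)) \<ge> 0)"

fun Acov :: "nat \<Rightarrow> (nat \<Rightarrow> complex mat) \<Rightarrow> (nat \<Rightarrow> complex mat) \<Rightarrow> nat \<Rightarrow> complex mat" where
  "Acov M H Q 0 = 1\<^sub>m M"
| "Acov M H Q (Suc k) = Acov M H Q k + mat_adjoint (H k) * Q k * H k"

definition rate :: "nat \<Rightarrow> nat \<Rightarrow> (nat \<Rightarrow> real) \<Rightarrow> (nat \<Rightarrow> complex mat) \<Rightarrow> (nat \<Rightarrow> complex mat) \<Rightarrow> real" where
  "rate M K \<mu> H Q = (\<Sum>k<K. \<mu> k * log 2 (Re (det (Acov M H Q (Suc k))) / Re (det (Acov M H Q k))))"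

definition C_DPC :: "nat \<Rightarrow> nat \<Rightarrow> nat \<Rightarrow> (nat \<Rightarrow> real) \<Rightarrow> (nat \<Rightarrow> complex mat) \<Rightarrow> real \<Rightarrow> real" where
  "C_DPC M K N \<mu> H P = Sup {rate M K \<mu> H Q | Q. (\<forall>k<K. psd N (Q k)) \<and> (\<Sum>k<K. Re (mtrace (Q k))) \<le> P}"

definition stacked :: "nat \<Rightarrow> nat \<Rightarrow> nat \<Rightarrow> (nat \<Rightarrow> complex mat) \<Rightarrow> complex mat" where
  "stacked M K N H = mat (K * N) M (\<lambda>(i,j). H (i div N) $$ (i mod N, j))"

end

theory Submission
  imports Defs
begin

text \<open>
  Summation by parts turns the rate into a combination of the numbers \<open>ln |A\<^sup>k|\<close> with the nonnegative
  weights \<open>\<mu>\<^sub>k - \<mu>\<^sub>k\<^sub>+\<^sub>1\<close>. If \<open>S\<close> stacks the first \<open>k\<close> channels, \<open>G = S S\<^sup>H\<close>, and \<open>D\<close> is the block-diagonal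
  matrix of the covariances, Sylvester's identity gives \<open>|A\<^sup>k| = |1 + D G| = |G\<inverse> + D| |G|\<close>. For a positive
  semidefinite \<open>X\<close> and positive \<open>d\<^sub>i\<close>, the inequality \<open>x \<le> exp (x - 1)\<close> applied to the eigenvalues of the
  diagonally rescaled \<open>X\<close> yields \<open>|X| \<le> (\<Prod>d\<^sub>i) exp (\<Sum>X\<^sub>i\<^sub>i / d\<^sub>i - n)\<close>. With \<open>X = G\<inverse> + D\<close> and
  \<open>d\<^sub>i = \<mu>\<^sub>j P / N\<close>, the contribution of \<open>D\<close> to the exponents is, after weighting, at most 0 by the trace
  constraint, and that of \<open>G\<inverse>\<close> is of order \<open>1 / P\<close>. The scaled identities attain \<open>|G| \<Prod>d\<^sub>i\<close> up to a factor
  tending to 1.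
\<close>

section \<open>Positive semidefinite matrices\<close>

lemma adjoint_carrier [simp]: "A \<in> carrier_mat m n \<Longrightarrow> mat_adjoint A \<in> carrier_mat n m"
  unfolding mat_adjoint_def carrier_mat_def by auto

lemma dim_adjoint [simp]:
  "dim_row (mat_adjoint A) = dim_col A" "dim_col (mat_adjoint A) = dim_row A"
  unfolding mat_adjoint_def by auto

lemma adjoint_index [simp]:
  fixes A :: "complex mat"
  assumes "i < dim_col A" "j < dim_row A"
  shows "mat_adjoint A $$ (i,j) = cnj (A $$ (j,i))"
  using assms unfolding mat_adjoint_def by (simp add: mat_of_rows_def)

lemma adjoint_adjoint [simp]: "mat_adjoint (mat_adjoint A) = (A :: complex mat)"
  by (rule eq_matI) auto

lemma adjoint_one [simp]: "mat_adjoint (1\<^sub>m n) = (1\<^sub>m n :: complex mat)"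
  by (rule eq_matI) auto

lemma adjoint_add:
  fixes A B :: "complex mat"
  assumes "A \<in> carrier_mat m n" "B \<in> carrier_mat m n"
  shows "mat_adjoint (A + B) = mat_adjoint A + mat_adjoint B"
  using assms by (intro eq_matI) auto

lemma adjoint_mult:
  fixes A B :: "complex mat"
  assumes "A \<in> carrier_mat m n" "B \<in> carrier_mat n l"
  shows "mat_adjoint (A * B) = mat_adjoint B * mat_adjoint A"
  using assms by (intro eq_matI) (auto simp: scalar_prod_def mult.commute intro!: sum.cong)

lemma adjoint_inner:
  fixes A :: "complex mat"
  assumes A: "A \<in> carrier_mat m n" and v: "v \<in> carrier_vec n" and w: "w \<in> carrier_vec m"
  shows "conjugate (A *\<^sub>v v) \<bullet> w = conjugate v \<bullet> (mat_adjoint A *\<^sub>v w)"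
proof -
  have "conjugate (A *\<^sub>v v) \<bullet> w = (\<Sum>i<m. \<Sum>j<n. cnj (A $$ (i,j)) * cnj (v $ j) * w $ i)"
    using assms by (auto simp: scalar_prod_def sum_distrib_right atLeast0LessThan intro!: sum.cong)
  also have "\<dots> = (\<Sum>j<n. \<Sum>i<m. cnj (A $$ (i,j)) * cnj (v $ j) * w $ i)"
    by (rule sum.swap)
  also have "\<dots> = conjugate v \<bullet> (mat_adjoint A *\<^sub>v w)"
    using assms by (auto simp: scalar_prod_def sum_distrib_left atLeast0LessThan algebra_simps intro!: sum.cong)
  finally show ?thesis .
qed

lemma conjugate_inner_real:
  fixes v :: "complex vec"
  shows "conjugate v \<bullet> v = complex_of_real (\<Sum>i<dim_vec v. (cmod (v $ i))\<^sup>2)"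
  by (simp add: scalar_prod_def atLeast0LessThan complex_norm_square[symmetric] mult.commute[of "cnj _"] flip: of_real_power)

lemma conjugate_inner_pos:
  fixes v :: "complex vec"
  assumes "v \<in> carrier_vec n" "v \<noteq> 0\<^sub>v n"
  shows "Re (conjugate v \<bullet> v) > 0"
proof -
  obtain i where i: "i < n" "v $ i \<noteq> 0"
    using assms by (metis carrier_vecD eq_vecI index_zero_vec(1,2))
  show ?thesis
    unfolding conjugate_inner_real Re_complex_of_real
    using assms(1) i by (intro sum_pos2[where i = i]) auto
qed

section \<open>Closure properties of the positive semidefinite cone\<close>

lemma psd_carrier: "psd n X \<Longrightarrow> X \<in> carrier_mat n n"
  by (simp add: psd_def)

lemma psd_one: "psd n (1\<^sub>m n)"
  by (auto simp: psd_def conjugate_inner_real intro!: sum_nonneg)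

lemma psd_add: "psd n X \<Longrightarrow> psd n Y \<Longrightarrow> psd n (X + Y)"
  by (auto simp: psd_def adjoint_add add_mult_distrib_mat_vec[of _ n n] scalar_prod_add_distrib[of _ n]
      simp del: conjugate_zero_vec)

text \<open>With \<open>w = E v\<close>, the form of the product at \<open>v\<close> is that of
  \<open>X\<close> at \<open>w\<close>. Gram matrices, inverses and diagonal rescalings are all
  treated as congruences through this fact.\<close>

lemma psd_congruence:
  assumes X: "psd m X" and E: "E \<in> carrier_mat m n"
  shows "psd n (mat_adjoint E * X * E)"
proof -
  note Xc = psd_carrier[OF X]
  have "mat_adjoint (mat_adjoint E * X * E) = mat_adjoint E * mat_adjoint (mat_adjoint E * X)"
    using E Xc by (intro adjoint_mult[of _ n m]) auto
  also have "mat_adjoint (mat_adjoint E * X) = mat_adjoint X * mat_adjoint (mat_adjoint E)"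
    using E Xc by (intro adjoint_mult[of _ n m]) auto
  also have "mat_adjoint X = X" using X by (simp add: psd_def)
  also have "mat_adjoint E * (X * mat_adjoint (mat_adjoint E)) = mat_adjoint E * X * E"
    using E Xc by (simp, intro assoc_mult_mat[symmetric]) auto
  finally have herm: "mat_adjoint (mat_adjoint E * X * E) = mat_adjoint E * X * E" .
  have "Re (conjugate v \<bullet> ((mat_adjoint E * X * E) *\<^sub>v v)) \<ge> 0" if v: "v \<in> carrier_vec n" for v
  proof -
    have "(mat_adjoint E * X * E) *\<^sub>v v = mat_adjoint E *\<^sub>v (X *\<^sub>v (E *\<^sub>v v))"
      using E Xc v
      by (subst assoc_mult_mat_vec[of _ n m _ n], auto, subst assoc_mult_mat_vec[of _ n m _ m], auto)
    then have "conjugate v \<bullet> ((mat_adjoint E * X * E) *\<^sub>v v) = conjugate (E *\<^sub>v v) \<bullet> (X *\<^sub>v (E *\<^sub>v v))"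
      using adjoint_inner[OF E v, of "X *\<^sub>v (E *\<^sub>v v)"] E Xc v by simp
    then show ?thesis using X E v by (simp add: psd_def)
  qed
  with herm E Xc show ?thesis by (auto simp: psd_def)
qed

text \<open>Since \<open>G\<close> is Hermitian, taking adjoints in \<open>G * B = 1\<close> shows
  that the adjoint of \<open>B\<close> is a left inverse of \<open>G\<close>. Hence \<open>B\<close>
  is itself the congruence of \<open>G\<close> by \<open>B\<close>.\<close>

lemma psd_inverse:
  assumes G: "psd n G" and B: "B \<in> carrier_mat n n" and GB: "G * B = 1\<^sub>m n"
  shows "psd n B"
proof -
  note Gc = psd_carrier[OF G]
  have "mat_adjoint B * G = mat_adjoint (G * B)"
    using adjoint_mult[OF Gc B] G by (simp add: psd_def)
  also have "\<dots> = 1\<^sub>m n" by (simp add: GB)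
  finally have "mat_adjoint B * G * B = B" using B by simp
  with psd_congruence[OF G B] show ?thesis by simp
qed

section \<open>Eigenvalues, determinant and trace\<close>

lemma psd_inner_real:
  assumes X: "psd n X" and v: "v \<in> carrier_vec n"
  shows "Im (conjugate v \<bullet> (X *\<^sub>v v)) = 0"
proof -
  note Xc = psd_carrier[OF X]
  \<comment> \<open>\<open>psd\<close> constrains only the real part of the form; being Hermitian
    makes the form equal to its own conjugate.\<close>
  have "cnj (conjugate v \<bullet> (X *\<^sub>v v)) = conjugate (X *\<^sub>v v) \<bullet> v"
    using conjugate_conjugate_sprod[of v n "X *\<^sub>v v"] conjugate_vec_sprod_comm[of v n "X *\<^sub>v v"] Xc v by simp
  also have "\<dots> = conjugate v \<bullet> (X *\<^sub>v v)"
    using adjoint_inner[OF Xc v v] X by (simp add: psd_def)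
  finally show ?thesis by (simp add: complex_eq_iff)
qed

lemma psd_eigenvalue:
  assumes X: "psd n X" and e: "eigenvalue X e"
  shows "Im e = 0" "Re e \<ge> 0"
proof -
  obtain v where v: "v \<in> carrier_vec n" "v \<noteq> 0\<^sub>v n" and Xv: "X *\<^sub>v v = e \<cdot>\<^sub>v v"
    using e psd_carrier[OF X] unfolding eigenvalue_def eigenvector_def by auto
  define r where "r = Re (conjugate v \<bullet> v)"
  have r: "r > 0" "conjugate v \<bullet> v = complex_of_real r"
    using conjugate_inner_pos[OF v] conjugate_inner_real[of v] by (simp_all add: r_def)
  have "conjugate v \<bullet> (X *\<^sub>v v) = e * complex_of_real r"
    using v(1) r(2) by (simp add: Xv)
  then have "Im e * r = 0" "Re e * r \<ge> 0"
    using psd_inner_real[OF X v(1)] X v(1) by (auto simp: psd_def)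
  with r(1) show "Im e = 0" "Re e \<ge> 0" by (auto simp: zero_le_mult_iff)
qed

lemma mtrace_mult_comm:
  assumes A: "A \<in> carrier_mat n m" and B: "B \<in> carrier_mat m n"
  shows "mtrace (A * B) = mtrace (B * A)"
proof -
  have "mtrace (A * B) = (\<Sum>i<n. \<Sum>j<m. A $$ (i,j) * B $$ (j,i))"
    using A B by (auto simp: mtrace_def scalar_prod_def atLeast0LessThan intro!: sum.cong)
  also have "\<dots> = (\<Sum>j<m. \<Sum>i<n. A $$ (i,j) * B $$ (j,i))" by (rule sum.swap)
  also have "\<dots> = mtrace (B * A)"
    using A B by (auto simp: mtrace_def scalar_prod_def atLeast0LessThan mult.commute intro!: sum.cong)
  finally show ?thesis .
qed

text \<open>Schur triangularization suffices, without diagonalizing: the diagonal of the triangular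
  factor lists the roots of the characteristic polynomial, and determinant and trace are invariant
  under similarity.\<close>

lemma psd_spectrum:
  assumes X: "psd n X"
  obtains es :: "real list" where "length es = n" "\<forall>e\<in>set es. e \<ge> 0"
    "det X = complex_of_real (prod_list es)" "mtrace X = complex_of_real (sum_list es)"
proof -
  note Xc = psd_carrier[OF X]
  from char_poly_factorized[OF Xc] obtain as
    where cp: "char_poly X = (\<Prod>a\<leftarrow>as. [:- a, 1:])" and len: "length as = n" by auto
  obtain B P Q where "schur_decomposition X as = (B, P, Q)" by (cases "schur_decomposition X as")
  from schur_decomposition[OF Xc cp this]
  have wit: "similar_mat_wit X B P Q" and ut: "upper_triangular B" and diag: "diag_mat B = as" by auto
  note W = similar_mat_witD2[OF Xc wit]
  have real: "Im a = 0 \<and> Re a \<ge> 0" if "a \<in> set as" for a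
  proof -
    have "poly (char_poly X) a = 0"
      using that by (auto simp: cp poly_prod_list prod_list_zero_iff o_def)
    then show ?thesis using psd_eigenvalue[OF X] eigenvalue_root_char_poly[OF Xc] by blast
  qed
  have as: "as = map complex_of_real (map Re as)"
    using real by (auto simp: o_def complex_eq_iff intro!: map_idI[symmetric])
  have "det X = det B" using wit by (intro det_similar) (auto simp: similar_mat_def)
  also have "\<dots> = prod_list as" using det_upper_triangular[OF ut W(5)] diag by simp
  also have "\<dots> = complex_of_real (prod_list (map Re as))"
    by (subst as, induction as) auto
  finally have det: "det X = complex_of_real (prod_list (map Re as))" .
  have "mtrace X = mtrace (Q * (P * B))"
    unfolding W(3) using W by (intro mtrace_mult_comm[of _ n n]) auto
  also have "Q * (P * B) = Q * P * B" using W by (intro assoc_mult_mat[symmetric]) auto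
  also have "\<dots> = B" using W by simp
  also have "mtrace B = sum_list as"
    unfolding diag[symmetric] mtrace_def diag_mat_def
    by (simp add: interv_sum_list_conv_sum_set_nat atLeast0LessThan)
  also have "\<dots> = complex_of_real (sum_list (map Re as))"
    by (subst as, induction as) auto
  finally show ?thesis using that[of "map Re as"] len det real by auto
qed

lemma psd_det:
  assumes "psd n X"
  shows "Im (det X) = 0" "Re (det X) \<ge> 0"
proof -
  obtain es where "\<forall>e\<in>set es. (e::real) \<ge> 0" "det X = complex_of_real (prod_list es)"
    using psd_spectrum[OF assms] by metis
  then show "Im (det X) = 0" "Re (det X) \<ge> 0" by (auto intro!: prod_list_nonneg)
qed

text \<open>Multiply \<open>e \<le> exp (e - 1)\<close> over the eigenvalues; their nonnegativity
  allows the inequalities to be multiplied.\<close>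

lemma psd_det_le_exp_trace:
  assumes "psd n X"
  shows "Re (det X) \<le> exp (Re (mtrace X) - real n)"
proof -
  obtain es where es: "length es = n" "\<forall>e\<in>set es. (e::real) \<ge> 0"
    "det X = complex_of_real (prod_list es)" "mtrace X = complex_of_real (sum_list es)"
    using psd_spectrum[OF assms] by metis
  have "prod_list es \<le> exp (sum_list es - real (length es))" using es(2)
  proof (induction es)
    case (Cons e es)
    have "e * prod_list es \<le> exp (e - 1) * exp (sum_list es - real (length es))"
      using Cons exp_ge_add_one_self[of "e - 1"] by (intro mult_mono) (auto intro!: prod_list_nonneg)
    then show ?case by (simp add: exp_add[symmetric] algebra_simps)
  qed simp
  with es show ?thesis by simp
qed

section \<open>Real diagonal matrices and the rescaled determinant bound\<close>

lemma adjoint_mat_diag_real: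
  "mat_adjoint (mat_diag n (\<lambda>i. complex_of_real (f i))) = mat_diag n (\<lambda>i. complex_of_real (f i))"
  by (rule eq_matI) (auto simp: mat_diag_def)

lemma psd_mat_diag:
  assumes "\<And>i. i < n \<Longrightarrow> f i \<ge> 0"
  shows "psd n (mat_diag n (\<lambda>i. complex_of_real (f i)))"
proof -
  \<comment> \<open>Square roots exhibit the diagonal matrix as a congruence of the
    identity.\<close>
  let ?E = "mat_diag n (\<lambda>i. complex_of_real (sqrt (f i)))"
  have "mat_adjoint ?E * 1\<^sub>m n * ?E = mat_diag n (\<lambda>i. complex_of_real (sqrt (f i)) * complex_of_real (sqrt (f i)))"
    by (simp add: adjoint_mat_diag_real right_mult_one_mat[of _ n n])
  also have "\<dots> = mat_diag n (\<lambda>i. complex_of_real (f i))"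
    using assms by (intro eq_matI) (auto simp: mat_diag_def simp flip: of_real_mult)
  finally show ?thesis using psd_congruence[OF psd_one, of ?E n n] by simp
qed

lemma det_mat_diag: "det (mat_diag n f) = (\<Prod>i<n. f i)"
proof -
  have "det (mat_diag n f) = prod_list (diag_mat (mat_diag n f))"
    by (rule det_upper_triangular) (auto simp: mat_diag_def)
  also have "\<dots> = (\<Prod>i<n. f i)"
    by (simp add: diag_mat_def mat_diag_def atLeast0LessThan prod.list_conv_set_nth)
  finally show ?thesis .
qed

text \<open>Congruence by \<open>diag (1 / sqrt (d i))\<close> divides the determinant by the
  product of the \<open>d i\<close> and the diagonal entries by \<open>d i\<close>. Equality holds
  at \<open>X = diag d\<close>, so \<open>d\<close> can be tuned to the expected optimum.\<close>

lemma psd_det_le: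
  assumes X: "psd n X" and d: "\<And>i. i < n \<Longrightarrow> d i > 0"
  shows "Re (det X) \<le> (\<Prod>i<n. d i) * exp ((\<Sum>i<n. Re (X $$ (i,i)) / d i) - real n)"
proof -
  note Xc = psd_carrier[OF X]
  define E where "E = mat_diag n (\<lambda>i. complex_of_real (1 / sqrt (d i)))"
  have E: "E \<in> carrier_mat n n" by (simp add: E_def)
  have adjE: "mat_adjoint E = E" unfolding E_def by (rule adjoint_mat_diag_real)
  define Z where "Z = E * X * E"
  have Z: "psd n Z" using psd_congruence[OF X E] by (simp add: Z_def adjE)
  have pd: "(\<Prod>i<n. d i) > 0" using d by (intro prod_pos) auto
  have detE: "det E * det E = complex_of_real (1 / (\<Prod>i<n. d i))"
  proof -
    have "(\<Prod>i<n. 1 / sqrt (d i)) * (\<Prod>i<n. 1 / sqrt (d i)) = (\<Prod>i<n. 1 / d i)"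
      unfolding prod.distrib[symmetric] using d by (intro prod.cong) (auto simp: less_imp_le)
    also have "\<dots> = 1 / (\<Prod>i<n. d i)" by (simp add: prod_dividef)
    finally show ?thesis
      unfolding E_def det_mat_diag of_real_prod[symmetric] of_real_mult[symmetric] by simp
  qed
  have "det Z = det E * det E * det X"
    using E Xc by (simp add: Z_def det_mult[of _ n])
  then have 1: "Re (det Z) = Re (det X) / (\<Prod>i<n. d i)"
    unfolding detE by (simp add: Re_complex_of_real del: of_real_divide of_real_prod)
  have "Z $$ (i,i) = X $$ (i,i) / complex_of_real (d i)" if "i < n" for i
    using that d[OF that] Xc
    by (simp add: Z_def E_def mat_diag_mult_left[of _ n n] mat_diag_mult_right[of _ n n]
        of_real_mult[symmetric] del: of_real_mult)
  then have 2: "Re (mtrace Z) = (\<Sum>i<n. Re (X $$ (i,i)) / d i)"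
    using psd_carrier[OF Z] by (simp add: mtrace_def)
  show ?thesis
    using psd_det_le_exp_trace[OF Z] pd unfolding 1 2 by (simp add: field_simps)
qed

section \<open>Determinants of perturbed Gram matrices\<close>

text \<open>Sylvester's identity: \<open>?L * ?U\<close> and \<open>?V * ?L\<close> are two
  block-triangular factorizations of the same matrix \<open>?T\<close>, and \<open>?L\<close> has
  determinant 1.\<close>

lemma det_one_plus_mult_comm:
  fixes A B :: "'a :: idom mat"
  assumes A: "A \<in> carrier_mat m n" and B: "B \<in> carrier_mat n m"
  shows "det (1\<^sub>m m + A * B) = det (1\<^sub>m n + B * A)"
proof -
  let ?T = "four_block_mat (1\<^sub>m m) A (- B) (1\<^sub>m n)"
  let ?L = "four_block_mat (1\<^sub>m m) (0\<^sub>m m n) (- B) (1\<^sub>m n)"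
  let ?U = "four_block_mat (1\<^sub>m m) A (0\<^sub>m n m) (1\<^sub>m n + B * A)"
  let ?V = "four_block_mat (1\<^sub>m m + A * B) A (0\<^sub>m n m) (1\<^sub>m n)"
  have L: "det ?L = 1"
    using B by (subst det_four_block_mat_upper_right_zero[of _ m _ n]) auto
  have U: "det ?U = det (1\<^sub>m n + B * A)"
    using A B by (subst det_four_block_mat_lower_left_zero[of _ m _ n]) auto
  have V: "det ?V = det (1\<^sub>m m + A * B)"
    using A B by (subst det_four_block_mat_lower_left_zero[of _ m _ n]) auto
  have "?L * ?U = ?T"
  proof -
    have [simp]: "- B * A + (1\<^sub>m n + B * A) = 1\<^sub>m n"
      using A B by (intro eq_matI) auto
    show ?thesis
      using A B by (subst mult_four_block_mat[of _ m m _ n _ n _ _ m _ n]) auto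
  qed
  moreover have "?V * ?L = ?T"
  proof -
    have [simp]: "1\<^sub>m m + A * B + A * - B = 1\<^sub>m m"
      using A B by (intro eq_matI) auto
    show ?thesis
      using A B by (subst mult_four_block_mat[of _ m m _ n _ n _ _ m _ n]) auto
  qed
  ultimately have "?L * ?U = ?V * ?L" by simp
  then have "det ?L * det ?U = det ?V * det ?L"
    using A B by (simp add: det_mult[of _ "m + n", symmetric])
  then show ?thesis by (simp add: L U V)
qed

text \<open>A maximal independent set of columns has \<open>n\<close> members and so spans the whole
  space; solutions of \<open>A x = e_i\<close> form the columns of the inverse. A right inverse is
  easier than a rank to pass on to the first rows.\<close>

lemma full_row_rank_right_inverse:
  fixes A :: "'a :: field mat"
  assumes A: "A \<in> carrier_mat n m" and rank: "vec_space.rank n A = n"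
  obtains R where "R \<in> carrier_mat m n" "A * R = 1\<^sub>m n"
proof -
  interpret vec_space "TYPE('a)" n .
  have cA: "set (cols A) \<subseteq> carrier_vec n" using A cols_dim by blast
  obtain U where U: "maximal U (\<lambda>T. T \<subseteq> set (cols A) \<and> lin_indpt T)" and fU: "finite U"
    using maximal_exists_superset[of "set (cols A)" "\<lambda>T. T \<subseteq> set (cols A) \<and> lin_indpt T" "{}"]
    by (auto simp: finite_lin_indpt2)
  have Uc: "U \<subseteq> set (cols A)" "lin_indpt U" using U by (auto simp: maximal_def)
  have "card U = n" using rank_card_indpt[OF A U] rank by simp
  then have "basis U"
    using Uc cA fU by (intro dim_li_is_basis) (auto simp: dim_is_n)
  then have "carrier_vec n \<subseteq> span U" by (simp add: basis_def)
  also have "span U \<subseteq> col_space A"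
    unfolding col_space_def using Uc(1) by (rule span_is_monotone)
  finally have "\<exists>x\<in>carrier_vec m. A *\<^sub>v x = unit_vec n i" if "i < n" for i
    using that A unfolding col_space_eq[OF A] by (auto dest!: subsetD[of _ _ "unit_vec n i"])
  then obtain x where x: "\<And>i. i < n \<Longrightarrow> x i \<in> carrier_vec m \<and> A *\<^sub>v x i = unit_vec n i"
    by metis
  define R where "R = mat m n (\<lambda>(i,j). x j $ i)"
  have R: "R \<in> carrier_mat m n" by (simp add: R_def)
  have "A * R = 1\<^sub>m n"
  proof (rule mat_col_eqI)
    fix i assume "i < dim_col (1\<^sub>m n :: 'a mat)"
    then have i: "i < n" by simp
    have "col R i = x i" using x[OF i] i by (auto simp: R_def intro!: eq_vecI)
    then show "col (A * R) i = col (1\<^sub>m n) i"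
      using x[OF i] col_mult2[OF A R i] i by simp
  qed (use A R in auto)
  with R that show ?thesis by blast
qed

text \<open>Only nonvanishing is left to show: a kernel vector \<open>v\<close> would make the
  squared norm of \<open>v\<close> plus the nonnegative form of \<open>X\<close> at \<open>v\<close>
  equal to zero.\<close>

lemma psd_det_one_plus_pos:
  assumes X: "psd n X"
  shows "Re (det (1\<^sub>m n + X)) > 0"
proof -
  have psd: "psd n (1\<^sub>m n + X)" using psd_add psd_one X by blast
  note Xc = psd_carrier[OF X]
  have "det (1\<^sub>m n + X) \<noteq> 0"
  proof
    assume "det (1\<^sub>m n + X) = 0"
    then obtain v where v: "v \<in> carrier_vec n" "v \<noteq> 0\<^sub>v n" "(1\<^sub>m n + X) *\<^sub>v v = 0\<^sub>v n"
      using det_0_iff_vec_prod_zero[of "1\<^sub>m n + X" n] Xc by auto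
    have "(1\<^sub>m n + X) *\<^sub>v v = v + X *\<^sub>v v"
      using v(1) Xc by (simp add: add_mult_distrib_mat_vec[of _ n n])
    then have "v + X *\<^sub>v v = 0\<^sub>v n" using v(3) by simp
    then have "conjugate v \<bullet> (v + X *\<^sub>v v) = 0" using v(1) by (metis carrier_vec_conjugate scalar_prod_right_zero)
    moreover have "conjugate v \<bullet> (v + X *\<^sub>v v) = conjugate v \<bullet> v + conjugate v \<bullet> (X *\<^sub>v v)"
      using v(1) Xc by (intro scalar_prod_add_distrib[of _ n]) auto
    ultimately have "Re (conjugate v \<bullet> v) + Re (conjugate v \<bullet> (X *\<^sub>v v)) = 0"
      by (metis plus_complex.sel(1) zero_complex.sel(1))
    then show False using conjugate_inner_pos[OF v(1,2)] X v(1) unfolding psd_def by force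
  qed
  with psd_det[OF psd] show ?thesis by (simp add: complex_eq_iff less_le)
qed

section \<open>Gram matrices and the uniform log-determinant gap\<close>

lemma gram_psd:
  assumes "S \<in> carrier_mat n M"
  shows "psd n (S * mat_adjoint S)"
  using psd_congruence[OF psd_one, of "mat_adjoint S" M n] assms by simp

text \<open>A kernel vector \<open>v\<close> of the Gram matrix satisfies \<open>?w = 0\<close>,
  because the form of the Gram matrix at \<open>v\<close> is the squared norm of \<open>?w\<close>.
  The adjoint of \<open>S * R = 1\<close> then recovers \<open>v = 0\<close>.\<close>

lemma gram_det_pos:
  assumes S: "S \<in> carrier_mat n M" and R: "R \<in> carrier_mat M n" and SR: "S * R = 1\<^sub>m n"
  shows "Re (det (S * mat_adjoint S)) > 0"
proof -
  let ?G = "S * mat_adjoint S"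
  have "det ?G \<noteq> 0"
  proof
    assume "det ?G = 0"
    then obtain v where v: "v \<in> carrier_vec n" "v \<noteq> 0\<^sub>v n" "?G *\<^sub>v v = 0\<^sub>v n"
      using det_0_iff_vec_prod_zero[of ?G n] S by auto
    let ?w = "mat_adjoint S *\<^sub>v v"
    have w: "?w \<in> carrier_vec M" using adjoint_carrier[OF S] v(1) by (rule mult_mat_vec_carrier)
    have "S *\<^sub>v ?w = 0\<^sub>v n"
      using v S by (simp add: assoc_mult_mat_vec[of _ n M _ n])
    then have "conjugate ?w \<bullet> ?w = 0"
      using adjoint_inner[of "mat_adjoint S" M n v ?w] v S w by simp
    then have w0: "?w = 0\<^sub>v M" using conjugate_inner_pos[OF w] by (metis less_irrefl zero_complex.sel(1))
    have "v = mat_adjoint (S * R) *\<^sub>v v" using v by (simp add: SR)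
    also have "\<dots> = mat_adjoint R *\<^sub>v ?w"
      using S R v by (simp add: adjoint_mult[OF S R] assoc_mult_mat_vec[of _ n M _ n])
    also have "\<dots> = 0\<^sub>v n" using R by (auto simp: w0)
    finally show False using v by simp
  qed
  with psd_det[OF gram_psd[OF S]] show ?thesis by (simp add: complex_eq_iff less_le)
qed

text \<open>By the Leibniz formula the determinant is a polynomial in the entries.\<close>

lemma tendsto_det:
  fixes F :: "'b \<Rightarrow> complex mat"
  assumes "\<And>x. F x \<in> carrier_mat n n" "A \<in> carrier_mat n n"
    and "\<And>i j. i < n \<Longrightarrow> j < n \<Longrightarrow> ((\<lambda>x. F x $$ (i,j)) \<longlongrightarrow> A $$ (i,j)) net"
  shows "((\<lambda>x. det (F x)) \<longlongrightarrow> det A) net"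
  unfolding det_def'[OF assms(1)] det_def'[OF assms(2)]
  using assms(3) by (intro tendsto_sum tendsto_mult tendsto_const tendsto_prod)
    (auto dest: permutes_in_image)

text \<open>The error \<epsilon> is fixed before \<open>D\<close>, so the estimate survives a
  supremum over covariances at each \<open>P\<close>. The \<open>c i\<close> are the proportions in
  which the reference diagonal distributes power.\<close>

lemma log_det_gap:
  assumes S: "S \<in> carrier_mat n M" and R: "R \<in> carrier_mat M n" and SR: "S * R = 1\<^sub>m n"
    and c: "\<And>i. i < n \<Longrightarrow> c i > (0::real)"
  shows "\<exists>\<epsilon> :: real \<Rightarrow> real. (\<epsilon> \<longlongrightarrow> 0) at_top \<and> (\<forall>P D. P > 0 \<longrightarrow> psd n D \<longrightarrow>
       ln (Re (det (1\<^sub>m M + mat_adjoint S * D * S)))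
       - ln (Re (det (1\<^sub>m M + mat_adjoint S * mat_diag n (\<lambda>i. complex_of_real (c i * P)) * S)))
       \<le> (\<Sum>i<n. Re (D $$ (i,i)) / (c i * P)) - real n + \<epsilon> P)"
proof -
  define G where "G = S * mat_adjoint S"
  have G: "G \<in> carrier_mat n n" "psd n G" using S gram_psd[OF S] by (auto simp: G_def)
  have detG: "Re (det G) > 0" using gram_det_pos[OF S R SR] by (simp add: G_def)
  have "det G \<noteq> 0" using detG by auto
  \<comment> \<open>\<open>undefined\<close> merely fills the extension slot of the matrix ring
    record.\<close>
  from det_non_zero_imp_unit[OF G(1) this, of undefined]
  obtain B where B: "B \<in> carrier_mat n n" and BG: "B * G = 1\<^sub>m n" and GB: "G * B = 1\<^sub>m n"
    by (auto simp: Units_def ring_mat_def)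
  have psdB: "psd n B" using psd_inverse[OF G(2) B GB] .
  have sylv: "det (1\<^sub>m M + mat_adjoint S * D * S) = det (1\<^sub>m n + D * G)"
    if D: "D \<in> carrier_mat n n" for D
  proof -
    have "det (1\<^sub>m M + mat_adjoint S * (D * S)) = det (1\<^sub>m n + D * S * mat_adjoint S)"
      using S D by (intro det_one_plus_mult_comm) auto
    then show ?thesis
      using S D by (simp add: G_def assoc_mult_mat[of _ M n _ n _ M] assoc_mult_mat[of _ n n _ M _ n])
  qed
  \<comment> \<open>With \<open>E = diag (c i * P)\<close>, this is the inverse of \<open>E\<close>
    plus \<open>G\<close>. Thus \<open>1 + E * G = E * h P\<close> evaluates the reference
    determinant exactly, and \<open>h P\<close> tends to \<open>G\<close>.\<close>
  define h where "h P = mat_diag n (\<lambda>i. complex_of_real (1 / (c i * P))) + G" for P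
  \<comment> \<open>Two vanishing corrections: \<open>G\<close> against \<open>h P\<close> in the
    reference determinant, and the diagonal of \<open>B\<close>, the inverse of \<open>G\<close>, in
    the upper bound.\<close>
  define \<epsilon> where "\<epsilon> P = ln (Re (det G)) - ln (Re (det (h P))) + (\<Sum>i<n. Re (B $$ (i,i)) / (c i * P))" for P
  have "((\<lambda>P. det (h P)) \<longlongrightarrow> det G) at_top"
  proof (rule tendsto_det)
    fix i j assume ij: "i < n" "j < n"
    have "((\<lambda>P. complex_of_real (1 / (c j * P))) \<longlongrightarrow> of_real 0) at_top"
      using c[OF ij(2)]
      by (intro tendsto_of_real tendsto_divide_0[OF tendsto_const] filterlim_at_top_imp_at_infinity
          filterlim_tendsto_pos_mult_at_top[OF tendsto_const] filterlim_ident)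
    then have "((\<lambda>P. (if i = j then complex_of_real (1 / (c j * P)) else 0) + G $$ (i,j)) \<longlongrightarrow>
        (if i = j then of_real 0 else 0) + G $$ (i,j)) at_top"
      by (intro tendsto_add tendsto_const) (cases "i = j"; simp)
    then show "((\<lambda>P. h P $$ (i,j)) \<longlongrightarrow> G $$ (i,j)) at_top"
      using ij G(1) by (cases "i = j") (simp_all add: h_def mat_diag_def)
  qed (use G in \<open>auto simp: h_def\<close>)
  then have "((\<lambda>P. ln (Re (det (h P)))) \<longlongrightarrow> ln (Re (det G))) at_top"
    using detG by (intro tendsto_ln tendsto_Re) auto
  moreover have "((\<lambda>P. \<Sum>i<n. Re (B $$ (i,i)) / (c i * P)) \<longlongrightarrow> (\<Sum>i<n. 0)) at_top"
    using c
    by (intro tendsto_sum tendsto_divide_0[OF tendsto_const] filterlim_at_top_imp_at_infinity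
        filterlim_tendsto_pos_mult_at_top[OF tendsto_const] filterlim_ident) auto
  ultimately have "(\<epsilon> \<longlongrightarrow> ln (Re (det G)) - ln (Re (det G)) + (\<Sum>i<n. 0)) at_top"
    unfolding \<epsilon>_def by (intro tendsto_add tendsto_diff tendsto_const)
  then have "(\<epsilon> \<longlongrightarrow> 0) at_top" by simp
  moreover have "ln (Re (det (1\<^sub>m M + mat_adjoint S * D * S)))
       - ln (Re (det (1\<^sub>m M + mat_adjoint S * mat_diag n (\<lambda>i. complex_of_real (c i * P)) * S)))
       \<le> (\<Sum>i<n. Re (D $$ (i,i)) / (c i * P)) - real n + \<epsilon> P" if P: "P > 0" and D: "psd n D" for P D
  proof -
    note Dc = psd_carrier[OF D]
    define d where "d i = c i * P" for i
    have d: "d i > 0" if "i < n" for i using c that P by (simp add: d_def)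
    define p where "p = (\<Prod>i<n. d i)"
    have p: "p > 0" using d by (auto simp: p_def intro!: prod_pos)
    have psdDB: "psd n (D + B)" using D psdB by (rule psd_add)
    have "det (1\<^sub>m n + D * G) = det ((D + B) * G)"
      \<comment> \<open>Writing the identity as \<open>B * G\<close> extracts the fixed factor
        \<open>G\<close> and leaves a positive semidefinite matrix to bound.\<close>
      using Dc B G(1) by (simp add: add_mult_distrib_mat[of _ n n] BG comm_add_mat[of _ n n])
    also have "\<dots> = det (D + B) * det G" using Dc B G(1) by (intro det_mult) auto
    finally have e1: "Re (det (1\<^sub>m M + mat_adjoint S * D * S)) = Re (det (D + B)) * Re (det G)"
      using sylv[OF Dc] psd_det[OF G(2)] by simp
    have "Re (det (1\<^sub>m M + mat_adjoint S * D * S)) > 0"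
      using psd_congruence[OF D S] by (rule psd_det_one_plus_pos)
    then have pos: "Re (det (D + B)) > 0" using e1 detG by (simp add: zero_less_mult_iff)
    \<comment> \<open>The determinant bound is applied with the diagonal of the reference matrix as
      scaling.\<close>
    have "ln (Re (det (D + B))) \<le> ln (p * exp ((\<Sum>i<n. Re ((D + B) $$ (i,i)) / d i) - real n))"
      using psd_det_le[OF psdDB, of d] d pos p by (simp add: p_def)
    also have "\<dots> = ln p + (\<Sum>i<n. Re ((D + B) $$ (i,i)) / d i) - real n"
      using p by (simp add: ln_mult)
    also have "(\<Sum>i<n. Re ((D + B) $$ (i,i)) / d i)
        = (\<Sum>i<n. Re (D $$ (i,i)) / d i) + (\<Sum>i<n. Re (B $$ (i,i)) / d i)"
      using Dc B by (simp add: add_divide_distrib sum.distrib)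
    finally have up: "ln (Re (det (1\<^sub>m M + mat_adjoint S * D * S))) \<le> ln (Re (det G)) + ln p
        + (\<Sum>i<n. Re (D $$ (i,i)) / d i) + (\<Sum>i<n. Re (B $$ (i,i)) / d i) - real n"
      unfolding e1 using pos detG by (simp add: ln_mult)
    let ?E = "mat_diag n (\<lambda>i. complex_of_real (d i))"
    have "?E * mat_diag n (\<lambda>i. complex_of_real (1 / d i)) = 1\<^sub>m n"
    proof (rule eq_matI)
      fix i j assume "i < dim_row (1\<^sub>m n :: complex mat)" "j < dim_col (1\<^sub>m n :: complex mat)"
      then have "i < n" "j < n" "d j \<noteq> 0" using d[of j] by auto
      then show "(?E * mat_diag n (\<lambda>i. complex_of_real (1 / d i))) $$ (i,j) = 1\<^sub>m n $$ (i,j)"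
        unfolding mat_diag_diag by (simp add: mat_diag_def)
    qed (auto simp: mat_diag_def)
    then have "1\<^sub>m n + ?E * G = ?E * h P"
      unfolding h_def d_def[symmetric] using G(1)
      by (subst mult_add_distrib_mat[of _ n n _ n]) (auto simp del: mat_diag_diag)
    then have "det (1\<^sub>m n + ?E * G) = complex_of_real p * det (h P)"
      using G(1) det_mult[of ?E n "h P"] by (simp add: h_def det_mat_diag p_def)
    then have e2: "Re (det (1\<^sub>m M + mat_adjoint S * ?E * S)) = p * Re (det (h P))"
      using sylv[of ?E] by simp
    have "psd n ?E" using d by (intro psd_mat_diag) (simp add: less_imp_le)
    then have "Re (det (1\<^sub>m M + mat_adjoint S * ?E * S)) > 0"
      using psd_congruence[OF _ S] psd_det_one_plus_pos by blast
    then have "Re (det (h P)) > 0" using p e2 by (simp add: zero_less_mult_iff)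
    then have "ln (Re (det (1\<^sub>m M + mat_adjoint S * ?E * S))) = ln p + ln (Re (det (h P)))"
      using p by (simp add: e2 ln_mult)
    with up show ?thesis by (simp add: \<epsilon>_def d_def)
  qed
  ultimately show ?thesis by (intro exI[of _ \<epsilon>] conjI allI impI)
qed

section \<open>Block structure of the covariances\<close>

lemma sum_lessThan_mult:
  fixes f :: "nat \<Rightarrow> 'a :: comm_monoid_add"
  shows "(\<Sum>a<k * N. f a) = (\<Sum>j<k. \<Sum>i<N. f (j * N + i))"
proof -
  have "(\<Sum>a<k * N. f a) = (\<Sum>j<k. sum f {j * N..<j * N + N})" by (rule sum.nat_group[symmetric])
  also have "\<dots> = (\<Sum>j<k. \<Sum>i<N. f (j * N + i))"
    using sum.shift_bounds_nat_ivl[of f 0 "_ * N" N] by (simp add: add.commute atLeast0LessThan)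
  finally show ?thesis .
qed

lemma block_index_less:
  fixes N :: nat
  assumes "j < k" "i < N"
  shows "j * N + i < k * N"
proof -
  have "j * N + i < Suc j * N" using assms(2) by simp
  also have "\<dots> \<le> k * N" using assms(1) by (intro mult_right_mono) auto
  finally show ?thesis .
qed

text \<open>The index convention (\<open>div N\<close> for the user, \<open>mod N\<close> for the
  antenna) is that of \<open>stacked\<close>, so the two matrices can be multiplied.\<close>

definition block_diag :: "nat \<Rightarrow> nat \<Rightarrow> (nat \<Rightarrow> complex mat) \<Rightarrow> complex mat" where
  "block_diag N k Q = mat (k * N) (k * N)
     (\<lambda>(a,b). if a div N = b div N then Q (a div N) $$ (a mod N, b mod N) else 0)"

lemma block_diag_carrier [simp]: "block_diag N k Q \<in> carrier_mat (k * N) (k * N)"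
  by (simp add: block_diag_def)

lemma stacked_carrier [simp]: "stacked M k N H \<in> carrier_mat (k * N) M"
  by (simp add: stacked_def)

text \<open>Entries between different users vanish. Leaving \<open>f\<close> and \<open>g\<close>
  free covers both the quadratic form of the block matrix and the entries of its congruence by the
  stacked channels.\<close>

lemma block_diag_bilinear:
  fixes f g :: "nat \<Rightarrow> complex"
  shows "(\<Sum>a<k * N. \<Sum>b<k * N. f a * block_diag N k Q $$ (a,b) * g b)
     = (\<Sum>j<k. \<Sum>i<N. \<Sum>l<N. f (j * N + i) * Q j $$ (i,l) * g (j * N + l))"
proof -
  have "(\<Sum>b<k * N. f (j * N + i) * block_diag N k Q $$ (j * N + i, b) * g b)
      = (\<Sum>l<N. f (j * N + i) * Q j $$ (i,l) * g (j * N + l))" if j: "j < k" and i: "i < N" for i j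
  proof -
    have "(\<Sum>b<k * N. f (j * N + i) * block_diag N k Q $$ (j * N + i, b) * g b)
      = (\<Sum>j'<k. \<Sum>l<N. if j = j' then f (j * N + i) * Q j $$ (i,l) * g (j * N + l) else 0)"
      unfolding sum_lessThan_mult using block_index_less[OF j i] block_index_less i
      by (intro sum.cong refl) (simp add: block_diag_def)
    also have "\<dots> = (\<Sum>j'<k. if j = j' then \<Sum>l<N. f (j * N + i) * Q j $$ (i,l) * g (j * N + l) else 0)"
      by (intro sum.cong) auto
    finally show ?thesis using j by simp
  qed
  then show ?thesis by (simp add: sum_lessThan_mult[of _ k N])
qed

lemma quadratic_form_sum:
  assumes "X \<in> carrier_mat n n" "v \<in> carrier_vec n"
  shows "conjugate v \<bullet> (X *\<^sub>v v) = (\<Sum>a<n. \<Sum>b<n. cnj (v $ a) * X $$ (a,b) * v $ b)"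
  using assms by (auto simp: scalar_prod_def sum_distrib_left atLeast0LessThan mult.assoc intro!: sum.cong)

lemma congruence_index:
  assumes "S \<in> carrier_mat n m" "D \<in> carrier_mat n n" "x < m" "y < m"
  shows "(mat_adjoint S * D * S) $$ (x,y) = (\<Sum>a<n. \<Sum>b<n. cnj (S $$ (a,x)) * D $$ (a,b) * S $$ (b,y))"
proof -
  have "(mat_adjoint S * D * S) $$ (x,y) = (\<Sum>b<n. \<Sum>a<n. cnj (S $$ (a,x)) * D $$ (a,b) * S $$ (b,y))"
    using assms by (auto simp: scalar_prod_def sum_distrib_right atLeast0LessThan intro!: sum.cong)
  then show ?thesis by (subst sum.swap)
qed

lemma psd_block_diag:
  assumes Q: "\<And>j. j < k \<Longrightarrow> psd N (Q j)"
  shows "psd (k * N) (block_diag N k Q)"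
proof -
  have herm: "mat_adjoint (block_diag N k Q) = block_diag N k Q"
  proof (rule eq_matI)
    fix a b assume "a < dim_row (block_diag N k Q)" "b < dim_col (block_diag N k Q)"
    then have ab: "a < k * N" "b < k * N" by (simp_all add: block_diag_def)
    \<comment> \<open>The existence of an index below \<open>k * N\<close> excludes
      \<open>N = 0\<close>, so remainders modulo \<open>N\<close> are valid antenna indices.\<close>
    then have N: "N > 0" and j: "a div N < k" by (auto simp: less_mult_imp_div_less intro: gr0I)
    have "mat_adjoint (Q (a div N)) $$ (a mod N, b mod N) = Q (a div N) $$ (a mod N, b mod N)"
      using Q[OF j] by (simp add: psd_def)
    then have "cnj (Q (a div N) $$ (b mod N, a mod N)) = Q (a div N) $$ (a mod N, b mod N)"
      using psd_carrier[OF Q[OF j]] N by (subst (asm) adjoint_index) auto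
    then show "mat_adjoint (block_diag N k Q) $$ (a,b) = block_diag N k Q $$ (a,b)"
      using ab by (subst adjoint_index) (auto simp: block_diag_def)
  qed (auto simp: block_diag_def)
  have "Re (conjugate v \<bullet> (block_diag N k Q *\<^sub>v v)) \<ge> 0" if v: "v \<in> carrier_vec (k * N)" for v
  proof -
    define u where "u j = vec N (\<lambda>i. v $ (j * N + i))" for j
    have "conjugate v \<bullet> (block_diag N k Q *\<^sub>v v)
        = (\<Sum>j<k. \<Sum>i<N. \<Sum>l<N. cnj (v $ (j * N + i)) * Q j $$ (i,l) * v $ (j * N + l))"
      unfolding quadratic_form_sum[OF block_diag_carrier v] by (rule block_diag_bilinear)
    also have "\<dots> = (\<Sum>j<k. conjugate (u j) \<bullet> (Q j *\<^sub>v u j))"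
      using psd_carrier[OF Q] by (intro sum.cong refl) (subst quadratic_form_sum[of _ N], auto simp: u_def)
    also have "Re \<dots> \<ge> 0"
      using Q by (auto simp: psd_def u_def intro!: sum_nonneg)
    finally show ?thesis .
  qed
  with herm show ?thesis by (simp add: psd_def)
qed

section \<open>The recursive covariances as one congruence\<close>

lemma Acov_carrier:
  assumes "\<And>j. j < k \<Longrightarrow> H j \<in> carrier_mat N M"
  shows "Acov M H Q k \<in> carrier_mat M M"
  using assms
proof (induction k)
  case (Suc k)
  then have "H k \<in> carrier_mat N M" "Acov M H Q k \<in> carrier_mat M M" by auto
  then show ?case by (metis Acov.simps(2) add_carrier_mat adjoint_carrier carrier_matD carrier_matI index_mult_mat(2,3))
qed simp

text \<open>Entrywise, unrolling the recursion gives a sum over users, which is the block-diagonal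
  bilinear form in two columns of the stacked matrix. This brings \<open>Acov\<close> into the shape
  of the gap estimate.\<close>

lemma Acov_eq_stacked:
  assumes H: "\<And>j. j < k \<Longrightarrow> H j \<in> carrier_mat N M" and Q: "\<And>j. j < k \<Longrightarrow> Q j \<in> carrier_mat N N"
  shows "Acov M H Q k = 1\<^sub>m M + mat_adjoint (stacked M k N H) * block_diag N k Q * stacked M k N H"
    (is "_ = 1\<^sub>m M + mat_adjoint ?S * ?D * ?S")
proof (rule eq_matI)
  have S: "?S \<in> carrier_mat (k * N) M" and D: "?D \<in> carrier_mat (k * N) (k * N)" by auto
  fix x y assume "x < dim_row (1\<^sub>m M + mat_adjoint ?S * ?D * ?S)" "y < dim_col (1\<^sub>m M + mat_adjoint ?S * ?D * ?S)"
  then have xy: "x < M" "y < M" by (simp_all add: stacked_def)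
  have "Acov M H Q k $$ (x,y) = 1\<^sub>m M $$ (x,y)
      + (\<Sum>j<k. \<Sum>i<N. \<Sum>l<N. cnj (H j $$ (i,x)) * Q j $$ (i,l) * H j $$ (l,y))"
    using H Q
  proof (induction k)
    case (Suc k)
    have Hk: "H k \<in> carrier_mat N M" and Qk: "Q k \<in> carrier_mat N N" using Suc.prems by auto
    have "Acov M H Q (Suc k) $$ (x,y) = Acov M H Q k $$ (x,y) + (mat_adjoint (H k) * Q k * H k) $$ (x,y)"
      using xy Hk by simp
    then show ?case
      unfolding congruence_index[OF Hk Qk xy] using Suc by simp
  qed simp
  also have "(\<Sum>j<k. \<Sum>i<N. \<Sum>l<N. cnj (H j $$ (i,x)) * Q j $$ (i,l) * H j $$ (l,y))
      = (\<Sum>j<k. \<Sum>i<N. \<Sum>l<N. cnj (?S $$ (j * N + i, x)) * Q j $$ (i,l) * ?S $$ (j * N + l, y))"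
    using xy block_index_less by (intro sum.cong refl) (simp add: stacked_def)
  also have "\<dots> = (mat_adjoint ?S * ?D * ?S) $$ (x,y)"
    unfolding congruence_index[OF S D xy] by (rule block_diag_bilinear[symmetric])
  finally show "Acov M H Q k $$ (x,y) = (1\<^sub>m M + mat_adjoint ?S * ?D * ?S) $$ (x,y)"
    using xy by (simp add: stacked_def)
qed (use Acov_carrier[of k H N M Q] H in \<open>auto simp: stacked_def\<close>)

text \<open>Keeping the first \<open>k * N\<close> columns of \<open>R\<close> yields the leading
  block of the identity, since the shorter stack consists of the first rows of the longer
  one.\<close>

lemma stacked_right_inverse:
  assumes R: "R \<in> carrier_mat M (K * N)" "stacked M K N H * R = 1\<^sub>m (K * N)" and k: "k \<le> K"
  obtains R' where "R' \<in> carrier_mat M (k * N)" "stacked M k N H * R' = 1\<^sub>m (k * N)"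
proof
  let ?R = "mat M (k * N) (\<lambda>ij. R $$ ij)"
  show "?R \<in> carrier_mat M (k * N)" by simp
  show "stacked M k N H * ?R = 1\<^sub>m (k * N)"
  proof (rule eq_matI)
    fix i j assume "i < dim_row (1\<^sub>m (k * N) :: complex mat)" "j < dim_col (1\<^sub>m (k * N) :: complex mat)"
    then have ij: "i < k * N" "j < k * N" by simp_all
    moreover have "k * N \<le> K * N" using k by simp
    ultimately have ij': "i < K * N" "j < K * N" by linarith+
    have "(stacked M k N H * ?R) $$ (i,j) = (stacked M K N H * R) $$ (i,j)"
      using ij ij' R(1) by (auto simp: stacked_def scalar_prod_def intro!: sum.cong)
    then show "(stacked M k N H * ?R) $$ (i,j) = 1\<^sub>m (k * N) $$ (i,j)"
      using ij ij' by (simp add: R(2))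
  qed (auto simp: stacked_def)
qed

text \<open>Used in both directions: to expand the rate into log-determinants, and later to
  reassemble the trace terms user by user.\<close>

lemma summation_by_parts:
  fixes \<nu> f :: "nat \<Rightarrow> real"
  shows "(\<Sum>k<n. \<nu> k * (f (Suc k) - f k)) = (\<Sum>k<n. (\<nu> k - \<nu> (Suc k)) * f (Suc k)) + \<nu> n * f n - \<nu> 0 * f 0"
  by (induction n) (auto simp: algebra_simps)

lemma Acov_det_pos:
  assumes "\<And>j. j < k \<Longrightarrow> H j \<in> carrier_mat N M" "\<And>j. j < k \<Longrightarrow> psd N (Q j)"
  shows "Re (det (Acov M H Q k)) > 0"
proof -
  have "psd M (mat_adjoint (stacked M k N H) * block_diag N k Q * stacked M k N H)"
    using psd_block_diag[of k N Q] assms(2) by (intro psd_congruence) auto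
  then show ?thesis
    using assms psd_carrier by (subst Acov_eq_stacked[of k H N M Q]) (auto intro: psd_det_one_plus_pos)
qed

section \<open>The candidate covariances and their gap\<close>

definition scaled_identity :: "nat \<Rightarrow> (nat \<Rightarrow> real) \<Rightarrow> real \<Rightarrow> nat \<Rightarrow> complex mat" where
  "scaled_identity N \<mu> P k = complex_of_real (\<mu> k * P / real N) \<cdot>\<^sub>m 1\<^sub>m N"

lemma scaled_identity_psd:
  assumes "\<mu> k \<ge> 0" "P \<ge> 0"
  shows "psd N (scaled_identity N \<mu> P k)"
proof -
  have "scaled_identity N \<mu> P k = mat_diag N (\<lambda>_. complex_of_real (\<mu> k * P / real N))"
    by (rule eq_matI) (auto simp: scaled_identity_def mat_diag_def)
  then show ?thesis using assms by (simp only: psd_mat_diag divide_nonneg_nonneg mult_nonneg_nonneg of_nat_0_le_iff)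
qed

lemma scaled_identity_trace:
  assumes "N \<ge> 1"
  shows "Re (mtrace (scaled_identity N \<mu> P k)) = \<mu> k * P"
  using assms by (simp add: scaled_identity_def mtrace_def)

lemma block_diag_scaled_identity:
  assumes "N \<ge> 1"
  shows "block_diag N k (scaled_identity N \<mu> P) = mat_diag (k * N) (\<lambda>a. complex_of_real (\<mu> (a div N) / real N * P))"
proof (rule eq_matI)
  fix a b
  assume "a < dim_row (mat_diag (k * N) (\<lambda>a. complex_of_real (\<mu> (a div N) / real N * P)))"
    "b < dim_col (mat_diag (k * N) (\<lambda>a. complex_of_real (\<mu> (a div N) / real N * P)))"
  then have ab: "a < k * N" "b < k * N" by (simp_all add: mat_diag_def)
  have "a = b \<longleftrightarrow> a div N = b div N \<and> a mod N = b mod N" by (metis div_mult_mod_eq)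
  then show "block_diag N k (scaled_identity N \<mu> P) $$ (a,b)
      = mat_diag (k * N) (\<lambda>a. complex_of_real (\<mu> (a div N) / real N * P)) $$ (a,b)"
    using ab assms by (auto simp: block_diag_def mat_diag_def scaled_identity_def)
qed (auto simp: block_diag_def mat_diag_def)

text \<open>The gap estimate with \<open>c a = \<mu> (a div N) / N\<close>, for which the reference
  diagonal is the candidate; summing its exponent within each block produces the traces.\<close>

lemma log_det_Acov_gap:
  assumes N: "N \<ge> 1" and H: "\<And>j. j < k \<Longrightarrow> H j \<in> carrier_mat N M"
    and R: "R \<in> carrier_mat M (k * N)" "stacked M k N H * R = 1\<^sub>m (k * N)"
    and \<mu>: "\<And>j. j < k \<Longrightarrow> \<mu> j > 0"
  shows "\<exists>\<epsilon> :: real \<Rightarrow> real. (\<epsilon> \<longlongrightarrow> 0) at_top \<and> (\<forall>P Q. P > 0 \<longrightarrow> (\<forall>j<k. psd N (Q j)) \<longrightarrow>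
       ln (Re (det (Acov M H Q k))) - ln (Re (det (Acov M H (scaled_identity N \<mu> P) k)))
       \<le> (\<Sum>j<k. Re (mtrace (Q j)) / (\<mu> j / real N * P) - real N) + \<epsilon> P)"
proof -
  have c: "\<mu> (a div N) / real N > 0" if "a < k * N" for a
    using \<mu>[of "a div N"] that N by (simp add: less_mult_imp_div_less)
  obtain \<epsilon> :: "real \<Rightarrow> real" where \<epsilon>: "(\<epsilon> \<longlongrightarrow> 0) at_top" and gap:
    "\<forall>P D. P > 0 \<longrightarrow> psd (k * N) D \<longrightarrow>
       ln (Re (det (1\<^sub>m M + mat_adjoint (stacked M k N H) * D * stacked M k N H)))
       - ln (Re (det (1\<^sub>m M + mat_adjoint (stacked M k N H)
           * mat_diag (k * N) (\<lambda>a. complex_of_real (\<mu> (a div N) / real N * P)) * stacked M k N H)))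
       \<le> (\<Sum>a<k * N. Re (D $$ (a,a)) / (\<mu> (a div N) / real N * P)) - real (k * N) + \<epsilon> P"
    using log_det_gap[where c = "\<lambda>a. \<mu> (a div N) / real N", OF stacked_carrier R c] by blast
  have "ln (Re (det (Acov M H Q k))) - ln (Re (det (Acov M H (scaled_identity N \<mu> P) k)))
       \<le> (\<Sum>j<k. Re (mtrace (Q j)) / (\<mu> j / real N * P) - real N) + \<epsilon> P"
    if P: "P > 0" and Q: "\<And>j. j < k \<Longrightarrow> psd N (Q j)" for P Q
  proof -
    have "(\<Sum>a<k * N. Re (block_diag N k Q $$ (a,a)) / (\<mu> (a div N) / real N * P))
        = (\<Sum>j<k. \<Sum>i<N. Re (Q j $$ (i,i)) / (\<mu> j / real N * P))"
      unfolding sum_lessThan_mult using block_index_less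
      by (intro sum.cong refl) (simp add: block_diag_def)
    also have "\<dots> = (\<Sum>j<k. Re (mtrace (Q j)) / (\<mu> j / real N * P))"
      by (intro sum.cong refl)
        (simp add: mtrace_def sum_divide_distrib sum_distrib_right carrier_matD(1)[OF psd_carrier[OF Q]])
    finally have tr: "(\<Sum>a<k * N. Re (block_diag N k Q $$ (a,a)) / (\<mu> (a div N) / real N * P))
        = (\<Sum>j<k. Re (mtrace (Q j)) / (\<mu> j / real N * P))" .
    have 1: "Acov M H Q k = 1\<^sub>m M + mat_adjoint (stacked M k N H) * block_diag N k Q * stacked M k N H"
      using H psd_carrier[OF Q] by (intro Acov_eq_stacked) auto
    have 2: "Acov M H (scaled_identity N \<mu> P) k = 1\<^sub>m M + mat_adjoint (stacked M k N H)
        * mat_diag (k * N) (\<lambda>a. complex_of_real (\<mu> (a div N) / real N * P)) * stacked M k N H"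
      unfolding block_diag_scaled_identity[OF N, symmetric]
      using H by (intro Acov_eq_stacked) (auto simp: scaled_identity_def)
    show ?thesis
      using gap[rule_format, OF P psd_block_diag[of k N Q]] Q unfolding 1 2 tr by (simp add: sum_subtractf)
  qed
  with \<epsilon> show ?thesis by (intro exI[of _ \<epsilon>] conjI allI impI) auto
qed

section \<open>High-SNR optimality\<close>

text \<open>The sequence \<nu> continues \<mu> by 0 at \<open>K\<close>, which removes the upper
  boundary term; the lower one vanishes because the initial covariance is the identity.\<close>

lemma rate_by_parts:
  fixes \<mu> :: "nat \<Rightarrow> real"
  assumes H: "\<And>k. k < K \<Longrightarrow> H k \<in> carrier_mat N M" and Q: "\<And>k. k < K \<Longrightarrow> psd N (Q k)"
    and \<nu>: "\<And>k. k < K \<Longrightarrow> \<nu> k = \<mu> k" "\<nu> K = 0"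
  shows "rate M K \<mu> H Q = (\<Sum>k<K. (\<nu> k - \<nu> (Suc k)) * ln (Re (det (Acov M H Q (Suc k))))) / ln 2"
proof -
  define f where "f k = ln (Re (det (Acov M H Q k)))" for k
  have "rate M K \<mu> H Q = (\<Sum>k<K. \<nu> k * (f (Suc k) - f k) / ln 2)"
    unfolding rate_def
  proof (intro sum.cong refl)
    fix k assume "k \<in> {..<K}"
    then have k: "k < K" by simp
    have "Re (det (Acov M H Q (Suc k))) > 0" "Re (det (Acov M H Q k)) > 0"
      using H Q k by (auto intro!: Acov_det_pos[of _ H N] simp del: Acov.simps)
    then show "\<mu> k * log 2 (Re (det (Acov M H Q (Suc k))) / Re (det (Acov M H Q k)))
        = \<nu> k * (f (Suc k) - f k) / ln 2"
      using \<nu>(1)[OF k] by (simp add: log_def f_def ln_div del: Acov.simps)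
  qed
  also have "\<dots> = (\<Sum>k<K. (\<nu> k - \<nu> (Suc k)) * f (Suc k)) / ln 2"
    unfolding sum_divide_distrib[symmetric] summation_by_parts by (simp add: \<nu>(2) f_def)
  finally show ?thesis by (simp add: f_def del: Acov.simps)
qed

theorem theorem8:
  fixes K N M :: nat and H :: "nat \<Rightarrow> complex mat" and \<mu> :: "nat \<Rightarrow> real"
  assumes "K \<ge> 1" and "N \<ge> 1" and "M \<ge> K * N"
    and "\<And>k. k < K \<Longrightarrow> H k \<in> carrier_mat N M"
    and "vec_space.rank (K * N) (stacked M K N H) = K * N"
    and "\<And>i j. i \<le> j \<Longrightarrow> j < K \<Longrightarrow> \<mu> j \<le> \<mu> i"
    and "\<And>k. k < K \<Longrightarrow> \<mu> k \<ge> 0"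
    and "(\<Sum>k<K. \<mu> k) = 1"
  shows "((\<lambda>P. C_DPC M K N \<mu> H P
            - rate M K \<mu> H (\<lambda>k. complex_of_real (\<mu> k * P / real N) \<cdot>\<^sub>m 1\<^sub>m N)) \<longlongrightarrow> 0) at_top"
proof -
  note N = assms(2) and H = assms(4) and mono = assms(6) and \<mu> = assms(7) and sum1 = assms(8)
  obtain R where R: "R \<in> carrier_mat M (K * N)" "stacked M K N H * R = 1\<^sub>m (K * N)"
    using full_row_rank_right_inverse[OF stacked_carrier assms(5)] by blast
  \<comment> \<open>Values of \<mu> from \<open>K\<close> on are arbitrary. The cutoff makes the
    last weight \<open>w (K - 1)\<close> equal to \<open>\<mu> (K - 1)\<close>.\<close>
  define \<nu> where "\<nu> k = (if k < K then \<mu> k else 0)" for k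
  define w where "w k = \<nu> k - \<nu> (Suc k)" for k
  have w: "w k \<ge> 0" if "k < K" for k
    using that mono[of k "Suc k"] \<mu>[of k] by (auto simp: w_def \<nu>_def)
  define f where "f Q k = ln (Re (det (Acov M H Q (Suc k))))" for Q k
  have rate: "rate M K \<mu> H Q = (\<Sum>k<K. w k * f Q k) / ln 2" if "\<And>k. k < K \<Longrightarrow> psd N (Q k)" for Q
    unfolding w_def f_def using that H by (intro rate_by_parts) (auto simp: \<nu>_def)
  let ?Q0 = "\<lambda>P. scaled_identity N \<mu> P"
  \<comment> \<open>The exponent contributed by user \<open>j\<close>, zero at the candidate if
    \<open>\<mu> j > 0\<close>. If \<open>\<mu> j = 0\<close>, division by zero gives
    \<open>- N\<close>, but then all weights multiplying this term vanish.\<close>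
  define t where "t P Q j = Re (mtrace (Q j)) / (\<mu> j / real N * P) - real N" for P Q j
  have "\<exists>\<epsilon>. (\<epsilon> \<longlongrightarrow> 0) at_top \<and> (\<forall>P>0. \<forall>Q. (\<forall>j<K. psd N (Q j)) \<longrightarrow>
      w k * f Q k - w k * f (?Q0 P) k \<le> w k * (\<Sum>j<Suc k. t P Q j) + \<epsilon> P)"
    if k: "k < K" for k
  proof (cases "w k = 0")
    case True
    then show ?thesis by (intro exI[of _ "\<lambda>_. 0"]) simp
  next
    case False
    then have "w k > 0" using w[OF k] by simp
    \<comment> \<open>The gap estimate divides by the weights of users up to \<open>k\<close>. A
      positive drop at \<open>k\<close> forces \<open>\<mu> k > 0\<close>, and monotonicity extends
      this to earlier users.\<close>
    then have "\<mu> k > 0" using k \<mu>[of "Suc k"] by (auto simp: w_def \<nu>_def split: if_splits)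
    then have pos: "\<mu> j > 0" if "j < Suc k" for j using mono[of j k] that k by simp
    obtain R' where "R' \<in> carrier_mat M (Suc k * N)" "stacked M (Suc k) N H * R' = 1\<^sub>m (Suc k * N)"
      using stacked_right_inverse[OF R, of "Suc k"] k by auto
    then have "\<exists>\<epsilon> :: real \<Rightarrow> real. (\<epsilon> \<longlongrightarrow> 0) at_top \<and>
        (\<forall>P Q. P > 0 \<longrightarrow> (\<forall>j<Suc k. psd N (Q j)) \<longrightarrow>
          f Q k - f (?Q0 P) k \<le> (\<Sum>j<Suc k. t P Q j) + \<epsilon> P)"
      unfolding f_def t_def using k H pos by (intro log_det_Acov_gap[OF N]) auto
    then obtain \<epsilon> :: "real \<Rightarrow> real" where \<epsilon>: "(\<epsilon> \<longlongrightarrow> 0) at_top" and gap: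
      "\<And>P Q. P > 0 \<Longrightarrow> (\<forall>j<Suc k. psd N (Q j)) \<Longrightarrow>
         f Q k - f (?Q0 P) k \<le> (\<Sum>j<Suc k. t P Q j) + \<epsilon> P"
      by blast
    have "((\<lambda>P. w k * \<epsilon> P) \<longlongrightarrow> 0) at_top" using tendsto_mult_right_zero[OF \<epsilon>] .
    moreover have "w k * f Q k - w k * f (?Q0 P) k \<le> w k * (\<Sum>j<Suc k. t P Q j) + w k * \<epsilon> P"
      if "P > 0" "\<forall>j<K. psd N (Q j)" for P Q
      using mult_left_mono[OF gap[of P Q] w[OF k]] that k by (simp add: algebra_simps)
    ultimately show ?thesis by blast
  qed
  then obtain \<epsilon> where \<epsilon>: "\<And>k. k < K \<Longrightarrow> (\<epsilon> k \<longlongrightarrow> 0) at_top"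
    and gap: "\<And>k P Q. k < K \<Longrightarrow> P > 0 \<Longrightarrow> (\<forall>j<K. psd N (Q j)) \<Longrightarrow>
      w k * f Q k - w k * f (?Q0 P) k \<le> w k * (\<Sum>j<Suc k. t P Q j) + \<epsilon> k P"
    by metis
  define \<eta> where "\<eta> P = (\<Sum>k<K. \<epsilon> k P) / ln 2" for P
  have "((\<lambda>P. \<Sum>k<K. \<epsilon> k P) \<longlongrightarrow> (\<Sum>k<K. 0)) at_top" using \<epsilon> by (intro tendsto_sum) auto
  then have \<eta>: "(\<eta> \<longlongrightarrow> 0) at_top"
    unfolding \<eta>_def using tendsto_divide_zero[of "\<lambda>P. \<Sum>k<K. \<epsilon> k P" at_top "ln 2"] by simp
  have psd0: "psd N (?Q0 P k)" if "P > 0" "k < K" for P k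
    using \<mu>[OF that(2)] that(1) by (intro scaled_identity_psd) auto
  have upper: "rate M K \<mu> H Q \<le> rate M K \<mu> H (?Q0 P) + \<eta> P"
    if P: "P > 0" and Q: "\<forall>k<K. psd N (Q k)" and tr: "(\<Sum>k<K. Re (mtrace (Q k))) \<le> P" for P Q
  proof -
    \<comment> \<open>Needed for users with \<open>\<mu> j = 0\<close>: their weighted term is 0,
      which must not exceed a multiple of the trace.\<close>
    have trQ: "Re (mtrace (Q j)) \<ge> 0" if "j < K" for j
    proof -
      obtain es where "\<forall>e\<in>set es. (e::real) \<ge> 0" "mtrace (Q j) = complex_of_real (sum_list es)"
        using psd_spectrum[of N "Q j"] Q \<open>j < K\<close> by metis
      then show ?thesis by (simp add: sum_list_nonneg)
    qed
    \<comment> \<open>Undoing the summation by parts gives user \<open>k\<close> the weight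
      \<open>\<mu> k\<close>, which cancels the one in the denominator of \<open>t\<close>; hence
      the choice of powers proportional to \<mu>.\<close>
    have "(\<Sum>k<K. w k * (\<Sum>j<Suc k. t P Q j)) = (\<Sum>k<K. \<nu> k * ((\<Sum>j<Suc k. t P Q j) - (\<Sum>j<k. t P Q j)))"
      using summation_by_parts[of \<nu> "\<lambda>k. \<Sum>j<k. t P Q j" K] by (simp add: w_def \<nu>_def)
    also have "\<dots> = (\<Sum>k<K. \<mu> k * t P Q k)" by (simp add: \<nu>_def)
    also have "\<dots> \<le> (\<Sum>k<K. real N / P * Re (mtrace (Q k)) - real N * \<mu> k)"
    proof (intro sum_mono)
      fix k assume "k \<in> {..<K}"
      then show "\<mu> k * t P Q k \<le> real N / P * Re (mtrace (Q k)) - real N * \<mu> k"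
        using trQ[of k] P N by (cases "\<mu> k = 0") (auto simp: t_def field_simps)
    qed
    also have "\<dots> = real N / P * (\<Sum>k<K. Re (mtrace (Q k))) - real N"
      unfolding sum_subtractf sum_distrib_left[symmetric] sum1 by simp
    \<comment> \<open>The power budget balances the subtracted \<open>N\<close> exactly, as the
      weights sum to 1.\<close>
    also have "\<dots> \<le> real N / P * P - real N"
      using tr P by (intro diff_right_mono mult_left_mono) auto
    finally have "(\<Sum>k<K. w k * (\<Sum>j<Suc k. t P Q j)) \<le> 0" using P by simp
    moreover have "(\<Sum>k<K. w k * f Q k) - (\<Sum>k<K. w k * f (?Q0 P) k)
        \<le> (\<Sum>k<K. w k * (\<Sum>j<Suc k. t P Q j)) + (\<Sum>k<K. \<epsilon> k P)"
      unfolding sum_subtractf[symmetric] sum.distrib[symmetric]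
      using gap P Q by (intro sum_mono) auto
    ultimately have "(\<Sum>k<K. w k * f Q k) \<le> (\<Sum>k<K. w k * f (?Q0 P) k) + (\<Sum>k<K. \<epsilon> k P)" by linarith
    then have "(\<Sum>k<K. w k * f Q k) / ln 2 \<le> ((\<Sum>k<K. w k * f (?Q0 P) k) + (\<Sum>k<K. \<epsilon> k P)) / ln 2"
      by (intro divide_right_mono) auto
    then show ?thesis
      using rate[of Q] rate[of "?Q0 P"] Q psd0[OF P] by (simp add: \<eta>_def add_divide_distrib)
  qed
  have bounds: "0 \<le> C_DPC M K N \<mu> H P - rate M K \<mu> H (?Q0 P) \<and> C_DPC M K N \<mu> H P - rate M K \<mu> H (?Q0 P) \<le> \<eta> P"
    if P: "P > 0" for P
  proof -
    let ?A = "{rate M K \<mu> H Q | Q. (\<forall>k<K. psd N (Q k)) \<and> (\<Sum>k<K. Re (mtrace (Q k))) \<le> P}"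
    have "(\<Sum>k<K. Re (mtrace (?Q0 P k))) \<le> P"
      using N by (simp add: scaled_identity_trace sum_distrib_right[symmetric] sum1)
    then have mem: "rate M K \<mu> H (?Q0 P) \<in> ?A" using psd0[OF P] by blast
    have ub: "x \<le> rate M K \<mu> H (?Q0 P) + \<eta> P" if "x \<in> ?A" for x using that upper[OF P] by blast
    \<comment> \<open>The uniform estimate also shows that the set is bounded above, as required for
      \<open>Sup\<close> to dominate its members.\<close>
    have "rate M K \<mu> H (?Q0 P) \<le> Sup ?A" using ub by (intro cSup_upper mem bdd_aboveI)
    moreover have "Sup ?A \<le> rate M K \<mu> H (?Q0 P) + \<eta> P" using mem ub by (intro cSup_least) auto
    ultimately show ?thesis by (simp add: C_DPC_def)
  qed
  have "((\<lambda>P. C_DPC M K N \<mu> H P - rate M K \<mu> H (?Q0 P)) \<longlongrightarrow> 0) at_top"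
    \<comment> \<open>The gap lies between 0 and \<eta> for \<open>P > 0\<close>, hence
      eventually.\<close>
    using bounds by (intro tendsto_sandwich[OF _ _ tendsto_const \<eta>])
      (auto intro!: eventually_mono[OF eventually_gt_at_top[of 0]])
  then show ?thesis by (simp add: scaled_identity_def[abs_def])
qed

end
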